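(* Let $\Gamma$ be a finite index subgroup of the discrete Heisenberg group $H$, and let $A$, $m_\Gamma$, $i_\Gamma$ be the associated data described in the context. Then for all $(x,y),(x',y')\in A\mathbb Z^2$, $$i_\Gamma(x,y)+i_\Gamma(x',y')+xy'= i_\Gamma(x+x',y+y') \mod m_\Gamma ,$$ and $$m_\Gamma\mid\det(A).$$ If, in addition, $\Gamma$ is a normal subgroup of $H$, then $m_\Gamma$ divides all the entries of the matrix $A$.
   Context: $H$ is the discrete Heisenberg group: the set $\mathbb Z^3$ with multiplication $(x,y,z)(x',y',z')=(x+x',y+y',z+z'+xy')$. Let $f:\mathbb Z\to H$, $f(z)=(0,0,z)$, and $g:H\to\mathbb Z^2$, $g(x,y,z)=(x,y)$. For a finite index subgroup $\Gamma$ of $H$: $m_\Gamma=[\operatorname{Im} f:\Gamma\cap\operatorname{Im} f]$; $A\in M(2,\mathbb Z)$ is a (necessarily nonsingular) integer matrix with $A\mathbb Z^2=g(\Gamma)$; and $i_\Gamma:A\mathbb Z^2\to\mathbb Z$ is defined by $i_\Gamma(x,y)=\min\{z\ge0:(x,y,z)\in\Gamma\}$. (One has $\Gamma=\{(x,y,i_\Gamma(x,y)+km_\Gamma):(x,y)\in A\mathbb Z^2,\ k\in\mathbb Z\}$.) *)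

theory Defs
  imports
    "HOL-Analysis.Analysis"
    "HOL-Algebra.Coset"
    "HOL-Number_Theory.Cong"
begin

text \<open>The discrete Heisenberg group on triples of integers; the \<open>x * y'\<close> term makes
  \<open>(x, y, z)\<close> correspond to the unipotent upper triangular matrix with \<open>x, y\<close> next to the
  diagonal and \<open>z\<close> in the corner.\<close>

definition heis :: "(int \<times> int \<times> int) monoid" where
  "heis = \<lparr>carrier = UNIV,
           monoid.mult = (\<lambda>(x, y, z) (x', y', z'). (x + x', y + y', z + z' + x * y')),
           one = (0, 0, 0)\<rparr>"

lemma group_heis: "group heis"
proof (rule groupI)
  fix p assume "p \<in> carrier heis"
  obtain x y z where p: "p = (x, y, z)" by (cases p)
  show "\<exists>q \<in> carrier heis. q \<otimes>\<^bsub>heis\<^esub> p = \<one>\<^bsub>heis\<^esub>"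
    by (rule bexI[where x = "(- x, - y, x * y - z)"]) (auto simp: heis_def p)
qed (auto simp: heis_def algebra_simps)

definition heis_f :: "int \<Rightarrow> int \<times> int \<times> int" where
  "heis_f z = (0, 0, z)"

definition heis_g :: "int \<times> int \<times> int \<Rightarrow> int ^ 2" where
  "heis_g = (\<lambda>(x, y, z). vector [x, y])"

definition finite_index :: "('a, 'b) monoid_scheme \<Rightarrow> 'a set \<Rightarrow> bool" where
  "finite_index G K \<longleftrightarrow> finite (rcosets\<^bsub>G\<^esub> K)"

text \<open>As usual for \<^const>\<open>card\<close>, the value is \<open>0\<close> when the index is infinite.\<close>

definition group_index :: "('a, 'b) monoid_scheme \<Rightarrow> 'a set \<Rightarrow> nat" where
  "group_index G K = card (rcosets\<^bsub>G\<^esub> K)"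

definition heis_m :: "(int \<times> int \<times> int) set \<Rightarrow> nat" where
  "heis_m \<Gamma> = group_index (heis\<lparr>carrier := range heis_f\<rparr>) (\<Gamma> \<inter> range heis_f)"

text \<open>Only meaningful for \<open>(x, y)\<close> in the image of \<open>\<Gamma>\<close> under \<^const>\<open>heis_g\<close>; elsewhere the
  set is empty and the value unspecified.\<close>

definition heis_i :: "(int \<times> int \<times> int) set \<Rightarrow> int \<Rightarrow> int \<Rightarrow> int" where
  "heis_i \<Gamma> x y = (LEAST z. 0 \<le> z \<and> (x, y, z) \<in> \<Gamma>)"

end

theory Submission
  imports Defs
begin

text \<open>
  Every assertion is an instance of one principle: an element \<open>(0, 0, n)\<close> lies in \<open>\<Gamma>\<close>
  exactly if \<open>m\<^sub>\<Gamma>\<close> divides \<open>n\<close> (lemma \<open>center_mem_iff_heis_m_dvd\<close>). Indeed the \<open>n\<close> with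
  \<open>(0, 0, n) \<in> \<Gamma>\<close> form a subgroup of the integers, hence the multiples of some \<open>d\<close>; finiteness
  of the index makes \<open>d\<close> nonzero, and then the number of cosets is \<open>d\<close>. It therefore suffices
  to exhibit suitable central elements of \<open>\<Gamma>\<close>.

  \<^item> Two elements of \<open>\<Gamma>\<close> with the same first two coordinates differ by a central element.
    Applied to the product of \<open>(x, y, i\<^sub>\<Gamma>(x, y))\<close> and \<open>(x', y', i\<^sub>\<Gamma>(x', y'))\<close>, compared with
    \<open>(x + x', y + y', i\<^sub>\<Gamma>(x + x', y + y'))\<close>, this is the cocycle congruence.

  \<^item> The commutator of \<open>(x, y, z)\<close> and \<open>(x', y', z')\<close> is \<open>(0, 0, x y' - x' y)\<close>. If the two
    elements lie above the columns of \<open>A\<close>, the last coordinate is \<open>det A\<close>.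

  \<^item> If \<open>\<Gamma>\<close> is normal, commutators of an element of \<open>\<Gamma>\<close> with arbitrary elements of the
    Heisenberg group lie in \<open>\<Gamma>\<close>. Commutators of \<open>(x, y, z)\<close> with \<open>(1, 0, 0)\<close> and \<open>(0, 1, 0)\<close>
    produce, up to sign, both coordinates \<open>x\<close> and \<open>y\<close> of each column of \<open>A\<close>.
\<close>

section \<open>Products and commutators in the Heisenberg group\<close>

lemma heis_mult: "(x, y, z) \<otimes>\<^bsub>heis\<^esub> (x', y', z') = (x + x', y + y', z + z' + x * y')"
  by (simp add: heis_def)

lemma heis_carrier: "p \<in> carrier heis"
  by (simp add: heis_def)

lemma heis_inv: "inv\<^bsub>heis\<^esub> (x, y, z) = (- x, - y, x * y - z)"
  by (rule group.inv_equality[OF group_heis])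
    (simp_all add: heis_carrier heis_mult, simp add: heis_def)

lemma subgroup_heis_mult:
  assumes "subgroup \<Gamma> heis" "(x, y, z) \<in> \<Gamma>" "(x', y', z') \<in> \<Gamma>"
  shows "(x + x', y + y', z + z' + x * y') \<in> \<Gamma>"
  using subgroup.m_closed[OF assms] by (simp add: heis_mult)

lemma subgroup_heis_inv:
  assumes "subgroup \<Gamma> heis" "(x, y, z) \<in> \<Gamma>"
  shows "(- x, - y, x * y - z) \<in> \<Gamma>"
  using subgroup.m_inv_closed[OF assms] by (simp add: heis_inv)

lemma subgroup_heis_fibre_diff:
  assumes "subgroup \<Gamma> heis" "(x, y, z) \<in> \<Gamma>" "(x, y, z') \<in> \<Gamma>"
  shows "(0, 0, z - z') \<in> \<Gamma>"
  using subgroup_heis_mult[OF assms(1,2) subgroup_heis_inv[OF assms(1,3)]] by simp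

lemma subgroup_heis_commutator:
  assumes "subgroup \<Gamma> heis" "(x, y, z) \<in> \<Gamma>" "(x', y', z') \<in> \<Gamma>"
  shows "(0, 0, x * y' - x' * y) \<in> \<Gamma>"
proof -
  \<comment> \<open>The two products in either order lie over the same point \<open>(x + x', y + y')\<close>.\<close>
  have "(x + x', y + y', z + z' + x * y') \<in> \<Gamma>"
    using assms by (rule subgroup_heis_mult)
  moreover have "(x + x', y + y', z + z' + x' * y) \<in> \<Gamma>"
    using subgroup_heis_mult[OF assms(1,3,2)] by (simp add: add.commute)
  ultimately show ?thesis
    using subgroup_heis_fibre_diff[OF assms(1)] by fastforce
qed

lemma normal_heis_commutator:
  assumes "normal \<Gamma> heis" "(x, y, z) \<in> \<Gamma>"
  shows "(0, 0, a * y - x * b) \<in> \<Gamma>"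
proof -
  interpret normal \<Gamma> heis by fact
  have "(a, b, 0) \<otimes>\<^bsub>heis\<^esub> (x, y, z) \<otimes>\<^bsub>heis\<^esub> inv\<^bsub>heis\<^esub> (a, b, 0) \<in> \<Gamma>"
    using assms(2) by (intro inv_op_closed2 heis_carrier)
  then have "(x, y, z + a * y - x * b) \<in> \<Gamma>"
    by (simp add: heis_mult heis_inv algebra_simps)
  from subgroup_heis_fibre_diff[OF is_subgroup this assms(2)] show ?thesis
    by (simp add: algebra_simps)
qed

section \<open>The central elements of a finite index subgroup\<close>

text \<open>Division with remainder by the least positive element.\<close>

lemma int_subgroup_eq_multiples:
  fixes K :: "int set"
  assumes diff: "\<And>a b. a \<in> K \<Longrightarrow> b \<in> K \<Longrightarrow> a - b \<in> K" and n: "n \<in> K" "n \<noteq> 0"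
  obtains d where "d > 0" "K = {z. int d dvd z}"
proof -
  have zero: "0 \<in> K" using diff[OF n(1) n(1)] by simp
  have neg: "- a \<in> K" if "a \<in> K" for a using diff[OF zero that] by simp
  have add: "a + b \<in> K" if "a \<in> K" "b \<in> K" for a b using diff[OF that(1) neg[OF that(2)]] by simp
  define P where "P k \<longleftrightarrow> k > 0 \<and> int k \<in> K" for k
  define d where "d = (LEAST k. P k)"
  have "P (nat \<bar>n\<bar>)" using n neg by (auto simp: P_def abs_if)
  then have "P d" unfolding d_def by (rule LeastI)
  then have d: "d > 0" "int d \<in> K" by (auto simp: P_def)
  have nat_mult: "int k * int d \<in> K" for k
    by (induction k) (auto simp: zero distrib_right intro: add d(2))
  have mult: "k * int d \<in> K" for k
    by (cases k rule: int_cases2) (use nat_mult neg in auto)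
  have "int d dvd z" if "z \<in> K" for z
  proof -
    have "z mod int d \<in> K"
      using diff[OF that mult[of "z div int d"]] by (simp add: minus_div_mult_eq_mod)
    moreover have "0 \<le> z mod int d" "z mod int d < int d" using d(1) by simp_all
    moreover from this have "\<not> P (nat (z mod int d))"
      using not_less_Least[of "nat (z mod int d)" P] by (simp add: d_def[symmetric] nat_less_iff)
    ultimately show ?thesis by (auto simp: P_def dvd_eq_mod_eq_0)
  qed
  then have "K = {z. int d dvd z}"
    using mult by (auto simp: mult.commute elim!: dvdE)
  with d(1) show ?thesis by (rule that)
qed

text \<open>Among the infinitely many central elements, two lie in the same coset of \<open>\<Gamma>\<close>.\<close>

lemma finite_index_meets_center:
  assumes sub: "subgroup \<Gamma> heis" and fin: "finite_index heis \<Gamma>"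
  obtains n where "n \<noteq> 0" "(0, 0, n) \<in> \<Gamma>"
proof -
  let ?c = "\<lambda>n :: int. \<Gamma> #>\<^bsub>heis\<^esub> (0, 0, n)"
  have "range ?c \<subseteq> rcosets\<^bsub>heis\<^esub> \<Gamma>"
    by (auto simp: RCOSETS_def heis_carrier)
  then have "finite (range ?c)"
    using fin unfolding finite_index_def by (rule finite_subset)
  then have "\<not> inj ?c"
    using finite_imageD infinite_UNIV_int by blast
  then obtain a b where ab: "a \<noteq> b" "?c a = ?c b"
    by (auto simp: inj_def)
  have "(0, 0, a) \<in> ?c b"
    using group.rcos_self[OF group_heis heis_carrier sub] ab(2) by metis
  then obtain h where h: "h \<in> \<Gamma>" "(0, 0, a) = h \<otimes>\<^bsub>heis\<^esub> (0, 0, b)"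
    by (auto simp: r_coset_def)
  then have "(0, 0, a - b) \<in> \<Gamma>"
    by (cases h) (simp add: heis_mult)
  with ab(1) show ?thesis by (intro that[of "a - b"]) auto
qed

text \<open>The cosets of the multiples of \<open>d\<close> in the centre are the residue classes modulo \<open>d\<close>.\<close>

lemma heis_m_eqI:
  assumes d: "d > 0" and mem: "\<And>n. (0, 0, n) \<in> \<Gamma> \<longleftrightarrow> int d dvd n"
  shows "heis_m \<Gamma> = d"
proof -
  let ?Z = "heis\<lparr>carrier := range heis_f\<rparr>"
  define C where "C r = heis_f ` {z. z mod int d = r}" for r
  have coset: "(\<Gamma> \<inter> range heis_f) #>\<^bsub>?Z\<^esub> heis_f a = C (a mod int d)" for a
  proof
    show "(\<Gamma> \<inter> range heis_f) #>\<^bsub>?Z\<^esub> heis_f a \<subseteq> C (a mod int d)"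
      by (auto simp: r_coset_def heis_f_def heis_mult mem C_def elim!: dvdE)
    show "C (a mod int d) \<subseteq> (\<Gamma> \<inter> range heis_f) #>\<^bsub>?Z\<^esub> heis_f a"
    proof
      fix p assume "p \<in> C (a mod int d)"
      then obtain z where z: "p = heis_f z" "z mod int d = a mod int d"
        by (auto simp: C_def)
      then have "heis_f (z - a) \<in> \<Gamma> \<inter> range heis_f"
        by (auto simp: heis_f_def mem mod_eq_dvd_iff)
      moreover have "p = heis_f (z - a) \<otimes>\<^bsub>?Z\<^esub> heis_f a"
        by (simp add: z(1) heis_f_def heis_mult)
      ultimately show "p \<in> (\<Gamma> \<inter> range heis_f) #>\<^bsub>?Z\<^esub> heis_f a"
        unfolding r_coset_def by blast
    qed
  qed
  have residues: "range (\<lambda>a. a mod int d) = {0..<int d}"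
  proof
    show "range (\<lambda>a. a mod int d) \<subseteq> {0..<int d}" using d by auto
    show "{0..<int d} \<subseteq> range (\<lambda>a. a mod int d)"
      by (auto simp: image_iff intro!: exI mod_pos_pos_trivial[symmetric])
  qed
  have "rcosets\<^bsub>?Z\<^esub> (\<Gamma> \<inter> range heis_f) = range (\<lambda>a. C (a mod int d))"
    unfolding RCOSETS_def coset[symmetric] by auto
  also have "\<dots> = C ` {0..<int d}"
    by (simp add: residues[symmetric] image_image)
  finally have "heis_m \<Gamma> = card (C ` {0..<int d})"
    by (simp add: heis_m_def group_index_def)
  also have "inj_on C {0..<int d}"
  proof (rule inj_onI)
    fix r s assume rs: "r \<in> {0..<int d}" "s \<in> {0..<int d}" "C r = C s"
    have "heis_f r \<in> C r" using rs(1) by (auto simp: C_def)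
    then show "r = s" using rs(2,3) rs(1) by (auto simp: C_def heis_f_def)
  qed
  then have "card (C ` {0..<int d}) = d"
    by (simp add: card_image)
  finally show ?thesis .
qed

lemma
  assumes sub: "subgroup \<Gamma> heis" and fin: "finite_index heis \<Gamma>"
  shows heis_m_pos: "heis_m \<Gamma> > 0"
    and center_mem_iff_heis_m_dvd: "(0, 0, n) \<in> \<Gamma> \<longleftrightarrow> int (heis_m \<Gamma>) dvd n"
proof -
  obtain k where k: "k \<noteq> 0" "(0, 0, k) \<in> \<Gamma>"
    using finite_index_meets_center[OF sub fin] .
  obtain d where d: "d > 0" "{z. (0, 0, z) \<in> \<Gamma>} = {z. int d dvd z}"
    by (rule int_subgroup_eq_multiples[of "{z. (0, 0, z) \<in> \<Gamma>}" k])
      (use k subgroup_heis_fibre_diff[OF sub] in auto)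
  moreover from d have "heis_m \<Gamma> = d" by (intro heis_m_eqI) auto
  ultimately show "heis_m \<Gamma> > 0" "(0, 0, n) \<in> \<Gamma> \<longleftrightarrow> int (heis_m \<Gamma>) dvd n" by auto
qed

section \<open>The fibres over the plane and the matrix\<close>

text \<open>The minimum defining \<open>i\<^sub>\<Gamma>\<close> is attained: translating \<open>(x, y, z)\<close> by powers of the
  central element \<open>(0, 0, m\<^sub>\<Gamma>)\<close> reaches nonnegative third coordinates.\<close>

lemma heis_i_mem:
  assumes sub: "subgroup \<Gamma> heis" and fin: "finite_index heis \<Gamma>" and mem: "(x, y, z) \<in> \<Gamma>"
  shows "(x, y, heis_i \<Gamma> x y) \<in> \<Gamma>"
proof -
  define Q where "Q k \<longleftrightarrow> (x, y, int k) \<in> \<Gamma>" for k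
  have "(0, 0, \<bar>z\<bar> * int (heis_m \<Gamma>)) \<in> \<Gamma>"
    by (simp add: center_mem_iff_heis_m_dvd[OF sub fin])
  from subgroup_heis_mult[OF sub mem this] have "(x, y, z + \<bar>z\<bar> * int (heis_m \<Gamma>)) \<in> \<Gamma>"
    by simp
  moreover have "\<bar>z\<bar> * 1 \<le> \<bar>z\<bar> * int (heis_m \<Gamma>)"
    using heis_m_pos[OF sub fin] by (intro mult_left_mono) auto
  moreover from this have "0 \<le> z + \<bar>z\<bar> * int (heis_m \<Gamma>)"
    by linarith
  ultimately have "Q (nat (z + \<bar>z\<bar> * int (heis_m \<Gamma>)))"
    by (simp add: Q_def)
  then have least: "Q (LEAST k. Q k)" by (rule LeastI)
  \<comment> \<open>The integers are not well-ordered, so the minimum is first taken over \<open>nat\<close>.\<close>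
  have "heis_i \<Gamma> x y = int (LEAST k. Q k)"
    unfolding heis_i_def
  proof (rule Least_equality)
    show "0 \<le> int (LEAST k. Q k) \<and> (x, y, int (LEAST k. Q k)) \<in> \<Gamma>"
      using least by (simp add: Q_def)
    fix w assume "0 \<le> w \<and> (x, y, w) \<in> \<Gamma>"
    then have "(LEAST k. Q k) \<le> nat w" "0 \<le> w"
      by (auto simp: Q_def intro: Least_le)
    then show "int (LEAST k. Q k) \<le> w" by simp
  qed
  with least show ?thesis by (simp add: Q_def)
qed

lemma vector_in_heis_g_image_iff:
  "(vector [x, y] :: int ^ 2) \<in> heis_g ` \<Gamma> \<longleftrightarrow> (\<exists>z. (x, y, z) \<in> \<Gamma>)"
proof
  assume "(vector [x, y] :: int ^ 2) \<in> heis_g ` \<Gamma>"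
  then obtain a b z where "(a, b, z) \<in> \<Gamma>" "(vector [x, y] :: int ^ 2) = vector [a, b]"
    by (auto simp: heis_g_def)
  then show "\<exists>z. (x, y, z) \<in> \<Gamma>" by (auto simp: vec_eq_iff forall_2)
next
  assume "\<exists>z. (x, y, z) \<in> \<Gamma>"
  then obtain z where "(x, y, z) \<in> \<Gamma>" ..
  then show "(vector [x, y] :: int ^ 2) \<in> heis_g ` \<Gamma>"
    by (intro image_eqI[where x = "(x, y, z)"]) (simp_all add: heis_g_def)
qed

lemma column_in_range_matrix_mult:
  fixes A :: "int ^ 2 ^ 2"
  shows "vector [A $ 1 $ j, A $ 2 $ j] \<in> range (\<lambda>v :: int ^ 2. A *v v)"
proof (rule range_eqI)
  show "vector [A $ 1 $ j, A $ 2 $ j] = A *v axis j 1"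
    by (simp add: vec_eq_iff forall_2 matrix_vector_mult_def axis_def if_distrib cong: if_cong)
qed

section \<open>The cocycle congruence and divisibility\<close>

theorem proposition3p2:
  fixes \<Gamma> :: "(int \<times> int \<times> int) set" and A :: "int ^ 2 ^ 2"
  assumes "subgroup \<Gamma> heis"
    and "finite_index heis \<Gamma>"
    and "range (\<lambda>v :: int ^ 2. A *v v) = heis_g ` \<Gamma>"
  shows "(\<forall>x y x' y'.
            vector [x, y] \<in> range (\<lambda>v :: int ^ 2. A *v v) \<longrightarrow>
            vector [x', y'] \<in> range (\<lambda>v :: int ^ 2. A *v v) \<longrightarrow>
            [heis_i \<Gamma> x y + heis_i \<Gamma> x' y' + x * y' = heis_i \<Gamma> (x + x') (y + y')]
              (mod int (heis_m \<Gamma>)))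
       \<and> int (heis_m \<Gamma>) dvd det A
       \<and> (normal \<Gamma> heis \<longrightarrow> (\<forall>i j. int (heis_m \<Gamma>) dvd A $ i $ j))"
proof (intro conjI allI impI)
  note center = center_mem_iff_heis_m_dvd[OF assms(1,2)]
  have column: "\<exists>z. (A $ 1 $ j, A $ 2 $ j, z) \<in> \<Gamma>" for j
    using column_in_range_matrix_mult[of A j]
    unfolding assms(3) vector_in_heis_g_image_iff .
  {
    fix x y x' y'
    assume "vector [x, y] \<in> range (\<lambda>v :: int ^ 2. A *v v)"
      and "vector [x', y'] \<in> range (\<lambda>v :: int ^ 2. A *v v)"
    then have "(x, y, heis_i \<Gamma> x y) \<in> \<Gamma>" "(x', y', heis_i \<Gamma> x' y') \<in> \<Gamma>"
      unfolding assms(3) vector_in_heis_g_image_iff using heis_i_mem[OF assms(1,2)] by blast+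
    then have prod: "(x + x', y + y', heis_i \<Gamma> x y + heis_i \<Gamma> x' y' + x * y') \<in> \<Gamma>"
      by (rule subgroup_heis_mult[OF assms(1)])
    from subgroup_heis_fibre_diff[OF assms(1) prod heis_i_mem[OF assms(1,2) prod]]
    show "[heis_i \<Gamma> x y + heis_i \<Gamma> x' y' + x * y' = heis_i \<Gamma> (x + x') (y + y')]
            (mod int (heis_m \<Gamma>))"
      by (simp add: center cong_iff_dvd_diff)
  next
    obtain z1 z2 where "(A $ 1 $ 1, A $ 2 $ 1, z1) \<in> \<Gamma>" "(A $ 1 $ 2, A $ 2 $ 2, z2) \<in> \<Gamma>"
      using column by blast
    from subgroup_heis_commutator[OF assms(1) this] show "int (heis_m \<Gamma>) dvd det A"
      by (simp add: center det_2)
  next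
    fix i j :: 2
    assume normal: "normal \<Gamma> heis"
    obtain z where z: "(A $ 1 $ j, A $ 2 $ j, z) \<in> \<Gamma>"
      using column by blast
    have "int (heis_m \<Gamma>) dvd A $ 1 $ j"
      using normal_heis_commutator[OF normal z, of 0 "-1"] by (simp add: center)
    moreover have "int (heis_m \<Gamma>) dvd A $ 2 $ j"
      using normal_heis_commutator[OF normal z, of 1 0] by (simp add: center)
    ultimately show "int (heis_m \<Gamma>) dvd A $ i $ j"
      using exhaust_2[of i] by auto
  }
qed

end
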